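(* Suppose $F:\mathbb{R}^d\to\mathbb{R}$ attains minimum value $0$ and satisfies second-order self-bounding regularity with function $\rho_1$. Let $\epsilon>0$ and $w_0\in\mathbb{R}^d$. Run Adaptive GD initialized at $w_0$, with adaptive step size $$\eta_{w_t}=\min\left\{\frac{1}{L_1'(w_0)},\ \frac{1}{\rho_0(F(w_0)+1)\,\|\nabla F(w_t)\|}\right\},\qquad L_1'(w_0)=\rho_1(F(w_0)+1).$$ Let $$T=\frac{2F(w_0)}{\min\left\{\frac{L_1'(w_0)}{\rho_0(F(w_0)+1)^2},\ \frac{\epsilon^2}{L_1'(w_0)}\right\}}.$$ Within $T+1$ oracle calls to $\nabla F(\cdot)$, Adaptive GD will output $T$ candidate vectors $(p_1,\ldots,p_T)$, one of which satisfies $\|\nabla F(p_t)\|\le\epsilon$.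
   Context: $\|\cdot\|$ is the Euclidean norm of vectors and $\|\cdot\|_{\mathrm{op}}$ the operator norm. Second-order self-bounding regularity: $F$ is twice differentiable and there is a non-decreasing function $\rho_1:\mathbb{R}_{\ge0}\to\mathbb{R}_{\ge0}$ such that $\|\nabla^2F(w)\|_{\mathrm{op}}\le\rho_1(F(w))$ for all $w\in\mathbb{R}^d$. Given $\rho_1$, define $\rho_0(x)=\rho_1(x)\sqrt{2\theta(x)}$ with $\theta(x)=\int_0^x\frac{1}{\rho_1(v)}\,dv$ for $x\ge0$. Adaptive GD is the iteration $w_{t+1}=w_t-\eta_{w_t}\nabla F(w_t)$; the candidate vectors it outputs are its successive iterates $w_0,w_1,\ldots$. *)

theory Defs
  imports "HOL-Analysis.Analysis"
begin

definition gradient :: "('v::euclidean_space \<Rightarrow> real) \<Rightarrow> 'v \<Rightarrow> 'v" where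
  "gradient F w = (THE g. GDERIV F w :> g)"

text \<open>The Hessian is taken as a linear operator, so that \<^const>\<open>onorm\<close> is its operator norm.\<close>

definition hessian :: "('v::euclidean_space \<Rightarrow> real) \<Rightarrow> 'v \<Rightarrow> 'v \<Rightarrow> 'v" where
  "hessian F w = frechet_derivative (gradient F) (at w)"

definition twice_differentiable :: "('v::euclidean_space \<Rightarrow> real) \<Rightarrow> bool" where
  "twice_differentiable F \<longleftrightarrow>
     (\<forall>w. F differentiable (at w)) \<and> (\<forall>w. gradient F differentiable (at w))"

definition attains_minimum_value :: "('v \<Rightarrow> real) \<Rightarrow> real \<Rightarrow> bool" where
  "attains_minimum_value F m \<longleftrightarrow> (\<forall>w. m \<le> F w) \<and> (\<exists>w. F w = m)"

text \<open>
  The function \<open>\<rho>\<^sub>1\<close> lives on the nonnegative reals; its values on negative arguments are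
  irrelevant here and are never used below.
\<close>

definition second_order_self_bounding ::
  "('v::euclidean_space \<Rightarrow> real) \<Rightarrow> (real \<Rightarrow> real) \<Rightarrow> bool" where
  "second_order_self_bounding F \<rho>\<^sub>1 \<longleftrightarrow>
     twice_differentiable F \<and>
     (\<forall>x\<ge>0. 0 \<le> \<rho>\<^sub>1 x) \<and> mono_on {0..} \<rho>\<^sub>1 \<and>
     (\<forall>w. onorm (hessian F w) \<le> \<rho>\<^sub>1 (F w))"

text \<open>
  If \<open>1 / \<rho>\<^sub>1\<close> is not integrable at \<open>0\<close> (in particular if \<open>\<rho>\<^sub>1\<close> vanishes on an interval
  \<open>[0, a]\<close>), then \<open>theta\<close> has no meaningful finite value. An Osgood-type argument shows that
  the only functions with minimum value \<open>0\<close> that are self-bounding for such a \<open>\<rho>\<^sub>1\<close>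
  are identically zero, so no integrability hypothesis on \<open>\<rho>\<^sub>1\<close> is imposed.
\<close>

definition theta :: "(real \<Rightarrow> real) \<Rightarrow> real \<Rightarrow> real" where
  "theta \<rho>\<^sub>1 x = integral {0..x} (\<lambda>v. 1 / \<rho>\<^sub>1 v)"

definition rho0 :: "(real \<Rightarrow> real) \<Rightarrow> real \<Rightarrow> real" where
  "rho0 \<rho>\<^sub>1 x = \<rho>\<^sub>1 x * sqrt (2 * theta \<rho>\<^sub>1 x)"

text \<open>
  The step size at a point where the gradient is \<open>g\<close>, started from a point of value \<open>F\<^sub>0\<close>.
  For \<open>g = 0\<close> the second term of the minimum is read as infinite.
\<close>

definition adaptive_step_size :: "(real \<Rightarrow> real) \<Rightarrow> real \<Rightarrow> 'v::real_normed_vector \<Rightarrow> real" where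
  "adaptive_step_size \<rho>\<^sub>1 F\<^sub>0 g =
     (if g = 0 then 1 / \<rho>\<^sub>1 (F\<^sub>0 + 1)
      else min (1 / \<rho>\<^sub>1 (F\<^sub>0 + 1)) (1 / (rho0 \<rho>\<^sub>1 (F\<^sub>0 + 1) * norm g)))"

datatype 'v gd_state =
  GD_State (iterate: 'v) (oracle_calls: nat) (candidates: "'v list")

text \<open>
  The algorithm sees the gradient only through its oracle: a round makes a single query, at
  the current iterate, and the answer serves both for the step size and for the direction.
  The current iterate is output as a candidate in the same round, so \<open>n\<close> rounds output the
  iterates \<open>w\<^sub>0, ..., w\<^sub>n\<^sub>-\<^sub>1\<close> in this order.
\<close>

fun gd_round ::
  "('v \<Rightarrow> 'v) \<Rightarrow> ('v \<Rightarrow> real) \<Rightarrow> 'v::real_vector gd_state \<Rightarrow> 'v gd_state" where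
  "gd_round orc \<eta> (GD_State w c ps) =
     (let g = orc w in GD_State (w - \<eta> g *\<^sub>R g) (Suc c) (ps @ [w]))"

definition adaptive_gd ::
  "('v \<Rightarrow> 'v) \<Rightarrow> ('v \<Rightarrow> real) \<Rightarrow> 'v::real_vector \<Rightarrow> nat \<Rightarrow> 'v gd_state" where
  "adaptive_gd orc \<eta> w\<^sub>0 n = (gd_round orc \<eta> ^^ n) (GD_State w\<^sub>0 0 [])"

text \<open>
  The number of candidates for a real bound \<open>T\<close>: rounded up, and at least one, since
  \<open>T = 0\<close> when the starting point is already a minimiser.
\<close>

definition num_candidates :: "real \<Rightarrow> nat" where
  "num_candidates T = max 1 (nat \<lceil>T\<rceil>)"

end

theory Submission
  imports Defs
begin

text \<open>
  Along the ray \<open>w - t \<nabla>F(w)\<close> with \<open>t \<le> 1 / \<rho>\<^sub>1(F(w))\<close> the value never exceeds \<open>F(w)\<close>, so the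
  curvature stays below \<open>\<rho>\<^sub>1(F(w))\<close> by monotonicity and the usual descent estimate applies.
  This gives \<open>\<parallel>\<nabla>F\<parallel>\<^sup>2 \<le> 2 \<rho>\<^sub>1(F) F\<close>, and a decrease of more than half of
  \<open>min {L / \<rho>\<^sub>0\<^sup>2, \<epsilon>\<^sup>2 / L}\<close> in every step whose gradient exceeds \<open>\<epsilon>\<close>; the value \<open>0\<close> bounds
  the number of such steps. The remaining point is that \<open>\<rho>\<^sub>0\<close> is positive, i.e. that \<open>1 / \<rho>\<^sub>1\<close>
  is integrable at \<open>0\<close> unless \<open>F(w\<^sub>0) = 0\<close>. For this let \<open>\<tau>(x)\<close> be the first time at which \<open>F\<close> reaches
  \<open>x\<close> on the segment from a minimiser to \<open>w\<^sub>0\<close>: the gradient bound makes \<open>(x - y) / \<rho>\<^sub>1(x)\<close> at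
  most a constant times \<open>\<tau>(x) - \<tau>(y)\<close>, and summing over a dyadic partition bounds the integral.
\<close>

section \<open>Descent estimates on the real line\<close>

lemma deriv_bound_imp_quadratic_bound:
  fixes f f' f'' :: "real \<Rightarrow> real"
  assumes f: "\<And>s. (f has_real_derivative f' s) (at s)"
    and f': "\<And>s. (f' has_real_derivative f'' s) (at s)"
    and K: "\<And>s. 0 \<le> s \<Longrightarrow> s < u \<Longrightarrow> f'' s \<le> K"
    and u: "0 \<le> u"
  shows "f u \<le> f 0 + f' 0 * u + K * u\<^sup>2 / 2"
proof -
  have cont: "continuous_on S f" "continuous_on S f'" for S
    using f f' by (auto intro!: DERIV_continuous_on intro: DERIV_subset)
  have slope: "f' s \<le> f' 0 + K * s" if s: "0 \<le> s" "s < u" for s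
  proof -
    have "f' s - K * s \<le> f' 0 - K * 0"
    proof (rule DERIV_nonpos_imp_decreasing_open[OF s(1)])
      fix x assume "0 < x" "x < s"
      then have "f'' x \<le> K" using K s by auto
      moreover have "((\<lambda>x. f' x - K * x) has_real_derivative f'' x - K) (at x)"
        by (auto intro!: derivative_eq_intros f')
      ultimately show "\<exists>y. ((\<lambda>x. f' x - K * x) has_real_derivative y) (at x) \<and> y \<le> 0"
        by fastforce
    qed (intro continuous_intros cont)
    then show ?thesis by simp
  qed
  let ?g = "\<lambda>x. f x - f' 0 * x - K * x\<^sup>2 / 2"
  have "?g u \<le> ?g 0"
  proof (rule DERIV_nonpos_imp_decreasing_open[OF u])
    fix x assume "0 < x" "x < u"
    then have "f' x - f' 0 - K * x \<le> 0" using slope[of x] by auto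
    moreover have "(?g has_real_derivative f' x - f' 0 - K * x) (at x)"
      by (auto intro!: derivative_eq_intros f)
    ultimately show "\<exists>y. (?g has_real_derivative y) (at x) \<and> y \<le> 0"
      by blast
  qed (intro continuous_intros cont; simp)
  then show ?thesis by simp
qed

text \<open>The bound on \<open>f''\<close> is known only where \<open>f\<close> is at most
  \<open>f 0\<close>, so \<open>f\<close> must be kept there. At a first return \<open>u\<close> to
  that level the quadratic bound would already be available, and \<open>K * u \<le> - f' 0\<close>
  turns it into \<open>f u \<le> f 0 + f' 0 * u / 2 < f 0\<close>.\<close>

lemma descent_within_sublevel:
  fixes f f' f'' :: "real \<Rightarrow> real"
  assumes f: "\<And>s. (f has_real_derivative f' s) (at s)"
    and f': "\<And>s. (f' has_real_derivative f'' s) (at s)"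
    and K: "\<And>s. f s \<le> f 0 \<Longrightarrow> f'' s \<le> K" "0 \<le> K"
    and neg: "f' 0 < 0" and t: "0 \<le> t" "K * t \<le> - f' 0"
  shows "f t \<le> f 0 + f' 0 * t + K * t\<^sup>2 / 2"
proof -
  have below: "f s < f 0" if s: "0 < s" "s \<le> t" for s
  proof (rule ccontr)
    assume "\<not> f s < f 0"
    obtain d where d: "d > 0" "\<And>h. 0 < h \<Longrightarrow> h < d \<Longrightarrow> f h < f 0"
      using DERIV_neg_dec_right[OF f neg] by auto
    \<comment> \<open>Starting the interval at \<open>r > 0\<close>, with \<open>f < f 0\<close> on
      \<open>(0, r)\<close>, keeps the set of returns compact and excludes 0;
      \<open>r \<le> s\<close> keeps \<open>s\<close> in it.\<close>
    define r where "r = min (d / 2) s"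
    let ?S = "{x \<in> {r..s}. f 0 \<le> f x}"
    have r: "0 < r" "r \<le> s" using d s by (auto simp: r_def)
    have "compact ({r..s} \<inter> {x. f 0 \<le> f x})"
      by (intro compact_Int_closed closed_Collect_le DERIV_continuous_on[of _ f f'] continuous_intros)
         (auto intro: f DERIV_subset)
    then have "compact ?S" by (simp add: Int_def)
    moreover have "s \<in> ?S" using r \<open>\<not> f s < f 0\<close> by auto
    ultimately obtain u where u: "u \<in> ?S" "\<And>x. x \<in> ?S \<Longrightarrow> u \<le> x"
      using compact_attains_inf[of ?S] by blast
    have lt: "f x \<le> f 0" if "0 \<le> x" "x < u" for x
    proof (cases "x < r")
      case True
      then show ?thesis using d(2)[of x] that d(1) by (cases "x = 0") (auto simp: r_def)
    next
      case False
      then show ?thesis using u(2)[of x] u(1) that by force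
    qed
    have u0: "0 < u" "u \<le> t" using u(1) r s by auto
    have "f u \<le> f 0 + f' 0 * u + K * u\<^sup>2 / 2"
      using lt K u0 by (intro deriv_bound_imp_quadratic_bound[OF f f']) auto
    moreover have "K * u \<le> - f' 0" using t(2) mult_left_mono[OF u0(2) K(2)] by linarith
    then have "(K * u) * u \<le> (- f' 0) * u" using u0 by (intro mult_right_mono) auto
    moreover have "f' 0 * u < 0" using neg u0 by (simp add: mult_neg_pos)
    ultimately have "f u < f 0" by (simp add: power2_eq_square algebra_simps)
    then show False using u by auto
  qed
  show ?thesis
  proof (rule deriv_bound_imp_quadratic_bound[OF f f' _ t(1)])
    fix s assume "0 \<le> s" "s < t"
    then show "f'' s \<le> K" using below[of s] K(1)[of s] by (cases "s = 0") auto
  qed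
qed

section \<open>Derivatives along lines and a single gradient step\<close>

lemma has_derivative_gradient:
  assumes "F differentiable (at w)"
  shows "(F has_derivative (\<lambda>h. h \<bullet> gradient F w)) (at w)"
proof -
  obtain D where D: "(F has_derivative D) (at w)" using assms by (auto simp: differentiable_def)
  then have lin: "linear D" by (rule has_derivative_linear)
  \<comment> \<open>The Riesz vector of \<open>D\<close> is its adjoint at 1; its uniqueness below
    gives the definite description in \<open>gradient\<close> a meaning.\<close>
  have "D h = h \<bullet> adjoint D 1" for h using adjoint_works[OF lin, of h 1] by (simp add: inner_commute)
  then have ex: "GDERIV F w :> adjoint D 1" using D unfolding gderiv_def by (metis ext)
  have "g = adjoint D 1" if "GDERIV F w :> g" for g
    using has_derivative_unique[OF that[unfolded gderiv_def] ex[unfolded gderiv_def]]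
    by (metis inner_commute vector_eq_ldot)
  then have "GDERIV F w :> gradient F w" unfolding gradient_def using ex by (metis theI)
  then show ?thesis by (simp add: gderiv_def)
qed

lemma derivatives_along_line:
  assumes "twice_differentiable F"
  shows "((\<lambda>s. F (w + s *\<^sub>R v)) has_real_derivative v \<bullet> gradient F (w + t *\<^sub>R v)) (at t)"
    and "((\<lambda>s. v \<bullet> gradient F (w + s *\<^sub>R v)) has_real_derivative
           v \<bullet> hessian F (w + t *\<^sub>R v) v) (at t)"
proof -
  let ?x = "w + t *\<^sub>R v"
  have line: "((\<lambda>s. w + s *\<^sub>R v) has_derivative (\<lambda>s. s *\<^sub>R v)) (at t)"
    by (auto intro!: derivative_eq_intros)
  have F: "(F has_derivative (\<lambda>h. h \<bullet> gradient F ?x)) (at ?x)"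
    using assms by (intro has_derivative_gradient) (simp add: twice_differentiable_def)
  have H: "(gradient F has_derivative hessian F ?x) (at ?x)"
    using assms by (simp add: twice_differentiable_def hessian_def frechet_derivative_works)
  show "((\<lambda>s. F (w + s *\<^sub>R v)) has_real_derivative v \<bullet> gradient F ?x) (at t)"
    using has_derivative_compose[OF line F] by (simp add: has_field_derivative_def mult_commute_abs)
  have "((\<lambda>s. gradient F (w + s *\<^sub>R v)) has_derivative (\<lambda>s. hessian F ?x (s *\<^sub>R v))) (at t)"
    using has_derivative_compose[OF line H] .
  from has_derivative_inner_right[OF this, of v]
  show "((\<lambda>s. v \<bullet> gradient F (w + s *\<^sub>R v)) has_real_derivative v \<bullet> hessian F ?x v) (at t)"
    by (simp add: has_field_derivative_def linear_scale[OF has_derivative_linear[OF H]]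
        mult_commute_abs)
qed

lemma hessian_quadratic_form_le:
  assumes "twice_differentiable F"
  shows "v \<bullet> hessian F w v \<le> onorm (hessian F w) * (norm v)\<^sup>2"
proof -
  have "(gradient F has_derivative hessian F w) (at w)"
    using assms by (simp add: twice_differentiable_def hessian_def frechet_derivative_works)
  then have "norm (hessian F w v) \<le> onorm (hessian F w) * norm v"
    by (intro onorm has_derivative_bounded_linear)
  then have "norm v * norm (hessian F w v) \<le> norm v * (onorm (hessian F w) * norm v)"
    by (intro mult_left_mono) auto
  then show ?thesis using norm_cauchy_schwarz[of v "hessian F w v"]
    by (simp add: power2_eq_square algebra_simps)
qed

text \<open>On the ray, points of value at most \<open>F w\<close> have curvature at most
  \<open>\<rho> (F w)\<close> by monotonicity, so the sublevel descent estimate applies. The product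
  form \<open>\<rho> (F w) * t \<le> 1\<close> leaves \<open>t\<close> unbounded when
  \<open>\<rho> (F w) = 0\<close>.\<close>

lemma gradient_step_decrease:
  assumes reg: "second_order_self_bounding F \<rho>" and nonneg: "\<And>w. 0 \<le> F w"
    and t: "0 \<le> t" "\<rho> (F w) * t \<le> 1"
  shows "F (w - t *\<^sub>R gradient F w) \<le> F w - (t - \<rho> (F w) * t\<^sup>2 / 2) * (norm (gradient F w))\<^sup>2"
proof (cases "gradient F w = 0")
  case False
  define g where "g = gradient F w"
  have td: "twice_differentiable F" using reg by (simp add: second_order_self_bounding_def)
  note deriv = derivatives_along_line[OF td, where w = w and v = "- g"]
  have rho: "0 \<le> \<rho> (F w)" using reg nonneg by (simp add: second_order_self_bounding_def)
  have "F (w + t *\<^sub>R - g) \<le> F (w + 0 *\<^sub>R - g) + - g \<bullet> gradient F (w + 0 *\<^sub>R - g) * t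
      + (\<rho> (F w) * (norm g)\<^sup>2) * t\<^sup>2 / 2"
  proof (rule descent_within_sublevel[OF deriv])
    fix s assume "F (w + s *\<^sub>R - g) \<le> F (w + 0 *\<^sub>R - g)"
    then have "\<rho> (F (w + s *\<^sub>R - g)) \<le> \<rho> (F w)"
      using reg nonneg by (auto simp: second_order_self_bounding_def mono_on_def)
    then have "onorm (hessian F (w + s *\<^sub>R - g)) \<le> \<rho> (F w)"
      using reg by (auto simp: second_order_self_bounding_def intro: order_trans)
    then have "onorm (hessian F (w + s *\<^sub>R - g)) * (norm (- g))\<^sup>2 \<le> \<rho> (F w) * (norm g)\<^sup>2"
      by (simp add: mult_right_mono)
    then show "- g \<bullet> hessian F (w + s *\<^sub>R - g) (- g) \<le> \<rho> (F w) * (norm g)\<^sup>2"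
      using hessian_quadratic_form_le[OF td, of "- g"] order_trans by blast
  next
    show "- g \<bullet> gradient F (w + 0 *\<^sub>R - g) < 0" using False by (simp add: g_def)
    have "(\<rho> (F w) * t) * (norm g)\<^sup>2 \<le> 1 * (norm g)\<^sup>2" using t by (intro mult_right_mono) auto
    then show "\<rho> (F w) * (norm g)\<^sup>2 * t \<le> - (- g \<bullet> gradient F (w + 0 *\<^sub>R - g))"
      by (simp add: g_def[symmetric] power2_norm_eq_inner algebra_simps)
  qed (use t rho in auto)
  then show ?thesis by (simp add: g_def[symmetric] power2_norm_eq_inner algebra_simps)
qed simp

text \<open>The decrease guaranteed for the step \<open>1 / \<rho> (F w)\<close> cannot exceed
  \<open>F w\<close>, since \<open>F\<close> stays nonnegative. If \<open>\<rho> (F w) = 0\<close>,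
  arbitrarily long steps are admissible and the gradient must vanish.\<close>

lemma gradient_norm_self_bound:
  assumes reg: "second_order_self_bounding F \<rho>" and nonneg: "\<And>w. 0 \<le> F w"
  shows "(norm (gradient F w))\<^sup>2 \<le> 2 * \<rho> (F w) * F w"
proof (cases "\<rho> (F w) = 0")
  case True
  have "(norm (gradient F w))\<^sup>2 \<le> 0"
  proof (rule ccontr)
    assume "\<not> ?thesis"
    then have pos: "(norm (gradient F w))\<^sup>2 > 0" by simp
    \<comment> \<open>Chosen so that the guaranteed decrease is \<open>F w + 1\<close>.\<close>
    define t where "t = (F w + 1) / (norm (gradient F w))\<^sup>2"
    have "0 \<le> t" using nonneg[of w] by (simp add: t_def)
    then have "F (w - t *\<^sub>R gradient F w) \<le> F w - t * (norm (gradient F w))\<^sup>2"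
      using gradient_step_decrease[OF reg nonneg, of t w] True by simp
    also have "\<dots> = -1" using pos by (simp add: t_def)
    finally show False using nonneg[of "w - t *\<^sub>R gradient F w"] by simp
  qed
  then show ?thesis using True by simp
next
  case False
  then have pos: "\<rho> (F w) > 0"
    using reg nonneg[of w] by (auto simp: second_order_self_bounding_def less_le)
  have "0 \<le> F (w - (1 / \<rho> (F w)) *\<^sub>R gradient F w)" by (rule nonneg)
  also have "\<dots> \<le> F w - (1 / \<rho> (F w) - \<rho> (F w) * (1 / \<rho> (F w))\<^sup>2 / 2) * (norm (gradient F w))\<^sup>2"
    using pos by (intro gradient_step_decrease[OF reg nonneg]) auto
  also have "1 / \<rho> (F w) - \<rho> (F w) * (1 / \<rho> (F w))\<^sup>2 / 2 = 1 / (2 * \<rho> (F w))"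
    using pos by (simp add: field_simps power2_eq_square)
  finally show ?thesis using pos by (simp add: field_simps)
qed

section \<open>Integrability of \<open>1 / \<rho>\<close> at 0\<close>

lemma integrable_on_nonincreasing:
  fixes h :: "real \<Rightarrow> real"
  assumes "\<And>x y. a \<le> x \<Longrightarrow> x \<le> y \<Longrightarrow> y \<le> b \<Longrightarrow> h y \<le> h x"
  shows "h integrable_on {a..b}"
proof -
  have "(\<lambda>x. - h x) integrable_on {a..b}"
    using assms by (intro integrable_on_mono_on mono_onI) auto
  then show ?thesis using integrable_neg by fastforce
qed

text \<open>On a dyadic partition of \<open>(0, b]\<close> the upper sums of \<open>h\<close> are
  dominated by telescoping increments of the bounded \<open>G\<close>; monotone convergence then
  reaches 0.\<close>

lemma integrable_on_nonincreasing_singularity: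
  fixes h G :: "real \<Rightarrow> real"
  assumes b: "0 < b" "b \<le> c"
    and nonneg: "\<And>x. 0 < x \<Longrightarrow> x \<le> c \<Longrightarrow> 0 \<le> h x"
    and anti: "\<And>x y. 0 < x \<Longrightarrow> x \<le> y \<Longrightarrow> y \<le> c \<Longrightarrow> h y \<le> h x"
    and G: "\<And>x. 0 < x \<Longrightarrow> x \<le> b \<Longrightarrow> 0 \<le> G x \<and> G x \<le> B"
    and hG: "\<And>x y. 0 < y \<Longrightarrow> y < x \<Longrightarrow> x \<le> b \<Longrightarrow> h x * (x - y) \<le> G x - G y"
  shows "h integrable_on {0..c}"
proof -
  define a where "a k = b / 2 ^ k" for k :: nat
  have a: "0 < a k" "a k \<le> b" "a (Suc k) = a k / 2" "a (Suc k) \<le> a k" for k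
    using b by (auto simp: a_def field_simps)
  have int: "h integrable_on {x..c}" if "0 < x" for x
    using that anti by (intro integrable_on_nonincreasing) auto
  have bound: "integral {a k..c} h \<le> integral {b..c} h + 2 * (G (a 1) - G (a (Suc k)))" for k
  proof (induction k)
    case 0
    then show ?case by (simp add: a_def)
  next
    case (Suc k)
    have int': "h integrable_on {a (Suc k)..a k}"
      using integrable_subinterval_real[OF int[OF a(1)[of "Suc k"]]] a[of k] b by auto
    have "integral {a (Suc k)..c} h = integral {a (Suc k)..a k} h + integral {a k..c} h"
      using a b by (intro Henstock_Kurzweil_Integration.integral_combine[symmetric] int) (auto intro: order_trans)
    also have "integral {a (Suc k)..a k} h \<le> integral {a (Suc k)..a k} (\<lambda>_. h (a (Suc k)))"
    proof (rule integral_le[OF int'])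
      fix x assume "x \<in> {a (Suc k)..a k}"
      then show "h x \<le> h (a (Suc k))"
        using a(1)[of "Suc k"] a(2)[of k] b by (intro anti) auto
    qed auto
    \<comment> \<open>\<open>hG\<close> controls \<open>h\<close> at the right end of an interval,
      but the estimate uses the left end \<open>a (Suc k)\<close>. That point is the right end of
      the next dyadic interval, which is half as long: hence the factor 2.\<close>
    also have "\<dots> = 2 * (h (a (Suc k)) * (a (Suc k) - a (Suc (Suc k))))"
      using a(4)[of k] by (simp add: a(3))
    also have "\<dots> \<le> 2 * (G (a (Suc k)) - G (a (Suc (Suc k))))"
      using a(1)[of k] a(2)[of "Suc k"] by (intro mult_left_mono hG) (auto simp: a(3))
    finally show ?case using Suc by simp
  qed
  define g where "g k x = (if x \<in> {a k..c} then h x else 0)" for k x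
  have sub: "{a k..c} \<inter> {0..c} = {a k..c}" for k using a(1)[of k] by auto
  have g_int: "g k integrable_on {0..c}" "integral {0..c} (g k) = integral {a k..c} h" for k
    using int[OF a(1)[of k]] unfolding g_def
    by (simp_all only: integrable_restrict_Int integral_restrict_Int sub)
  \<comment> \<open>All truncations vanish at 0, whereas \<open>h 0\<close> is arbitrary; the value
    there is restored at the end as a null set.\<close>
  have "(\<lambda>x. if x = 0 then 0 else h x) integrable_on {0..c} \<and>
    (\<lambda>k. integral {0..c} (g k)) \<longlonglongrightarrow> integral {0..c} (\<lambda>x. if x = 0 then 0 else h x)"
  proof (rule monotone_convergence_increasing[OF g_int(1)])
    show "g k x \<le> g (Suc k) x" if "x \<in> {0..c}" for k x
      using nonneg[of x] a(4)[of k] a(1)[of "Suc k"] that by (auto simp: g_def)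
    show "(\<lambda>k. g k x) \<longlonglongrightarrow> (if x = 0 then 0 else h x)" if x: "x \<in> {0..c}" for x
    proof (cases "x = 0")
      case True
      then have "g k x = 0" for k using a(1)[of k] by (simp add: g_def)
      then show ?thesis using True by simp
    next
      case False
      have "a \<longlonglongrightarrow> 0" unfolding a_def
        by (rule LIMSEQ_divide_realpow_zero) simp
      moreover have "0 < x" using x False by simp
      ultimately have "\<forall>\<^sub>F k in sequentially. a k < x" by (rule order_tendstoD)
      then have "\<forall>\<^sub>F k in sequentially. g k x = h x"
        by eventually_elim (use x in \<open>auto simp: g_def\<close>)
      then show ?thesis using False by (simp add: tendsto_eventually)
    qed
    have "norm (integral {0..c} (g k)) \<le> integral {b..c} h + 2 * B" for k
    proof -
      have "0 \<le> integral {a k..c} h"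
        using a(1)[of k] nonneg by (intro integral_nonneg int) auto
      moreover have "G (a 1) - G (a (Suc k)) \<le> B" using G[OF a(1,2), of 1] G[OF a(1,2), of "Suc k"] by linarith
      ultimately show ?thesis using bound[of k] by (simp add: g_int)
    qed
    then show "bounded (range (\<lambda>k. integral {0..c} (g k)))" by (auto simp: bounded_iff)
  qed
  then show ?thesis
    using integrable_spike[of "\<lambda>x. if x = 0 then 0 else h x" "{0..c}" "{0}" h] by auto
qed

lemma first_hitting_time:
  fixes f :: "real \<Rightarrow> real"
  assumes cont: "continuous_on {0..u} f" and x: "f 0 \<le> x" "x \<le> f u" and u: "0 \<le> u"
  shows "\<exists>t\<in>{0..u}. f t = x \<and> (\<forall>s. 0 \<le> s \<longrightarrow> s < t \<longrightarrow> f s < x)"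
proof -
  have "closed ({0..u} \<inter> f -` {x})"
    using cont by (intro continuous_closed_preimage) auto
  then have "compact ({0..u} \<inter> ({0..u} \<inter> f -` {x}))" by (intro compact_Int_closed) auto
  moreover have "{0..u} \<inter> ({0..u} \<inter> f -` {x}) \<noteq> {}" using IVT'[OF x u cont] by auto
  ultimately obtain t where t: "t \<in> {0..u}" "f t = x"
      "\<And>s. s \<in> {0..u} \<Longrightarrow> f s = x \<Longrightarrow> t \<le> s"
    using compact_attains_inf[of "{0..u} \<inter> ({0..u} \<inter> f -` {x})"]
    by (metis (no_types, lifting) Int_iff vimage_singleton_eq)
  have "f s < x" if s: "0 \<le> s" "s < t" for s
  proof (rule ccontr)
    assume "\<not> f s < x"
    then obtain r where "0 \<le> r" "r \<le> s" "f r = x"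
      using IVT'[of f 0 x s] continuous_on_subset[OF cont, of "{0..s}"] x s t(1) by auto
    then show False using t(1) t(3)[of r] s by auto
  qed
  then show ?thesis using t by blast
qed

text \<open>Osgood-type argument: were the integral of \<open>1 / \<rho>\<close> divergent at 0,
  \<open>f\<close> could not leave 0 in finite time. First hitting times \<open>\<tau>\<close> serve
  as the clock and supply \<open>G = 2 K \<tau>\<close> for the dyadic bound.\<close>

lemma escape_from_zero:
  fixes f f' \<rho> :: "real \<Rightarrow> real"
  assumes f: "\<And>s. (f has_real_derivative f' s) (at s)"
    and nonneg: "\<And>s. 0 \<le> f s"
    and self: "\<And>s. (f' s)\<^sup>2 \<le> 2 * K * \<rho> (f s) * f s"
    and K: "0 < K"
    and \<rho>: "\<And>x. 0 \<le> x \<Longrightarrow> 0 \<le> \<rho> x" "mono_on {0..} \<rho>"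
    and ends: "f 0 = 0" "0 < f 1" and c: "f 1 \<le> c"
  shows "(\<forall>x>0. 0 < \<rho> x) \<and> (\<lambda>x. 1 / \<rho> x) integrable_on {0..c}"
proof -
  have cont: "continuous_on S f" for S
    using f by (auto intro!: DERIV_continuous_on intro: DERIV_subset)
  have "\<exists>t. 0 \<le> t \<and> t \<le> 1 \<and> f t = x \<and> (\<forall>s. 0 \<le> s \<longrightarrow> s < t \<longrightarrow> f s < x)"
    if "x \<in> {0..f 1}" for x
    using first_hitting_time[OF cont, of x 1] that ends by auto
  then obtain \<tau> where \<tau>: "\<And>x. x \<in> {0..f 1} \<Longrightarrow> 0 \<le> \<tau> x \<and> \<tau> x \<le> 1 \<and> f (\<tau> x) = x"
      "\<And>x s. x \<in> {0..f 1} \<Longrightarrow> 0 \<le> s \<Longrightarrow> s < \<tau> x \<Longrightarrow> f s < x"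
    by metis
  \<comment> \<open>Before the first hitting time \<open>\<tau> x\<close> all values are below
    \<open>x\<close>, so monotonicity bounds \<open>f'\<close> at the mean value point by its bound
    at level \<open>x\<close>.\<close>
  have slope: "0 \<le> \<tau> x - \<tau> y \<and> (x - y)\<^sup>2 \<le> (\<tau> x - \<tau> y)\<^sup>2 * (2 * K * \<rho> x * x)"
    if xy: "0 \<le> y" "y < x" "x \<le> f 1" for x y
  proof -
    have "\<tau> y < \<tau> x"
    proof (rule ccontr)
      assume "\<not> \<tau> y < \<tau> x"
      then have "f (\<tau> x) \<le> y"
        using \<tau>(1)[of x] \<tau>(1)[of y] \<tau>(2)[of y "\<tau> x"] xy by (cases "\<tau> x = \<tau> y") auto
      then show False using \<tau>(1)[of x] xy by auto
    qed
    moreover obtain l z where z: "\<tau> y < z" "z < \<tau> x" "(f has_real_derivative l) (at z)"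
        "f (\<tau> x) - f (\<tau> y) = (\<tau> x - \<tau> y) * l"
      using MVT[OF \<open>\<tau> y < \<tau> x\<close> cont] f by (auto simp: real_differentiable_def)
    moreover have "l = f' z" using DERIV_unique[OF z(3) f] .
    moreover have "f z \<le> x" using \<tau>(2)[of x z] \<tau>(1)[of y] z xy by auto
    then have "\<rho> (f z) * f z \<le> \<rho> x * x"
      using \<rho> nonneg xy by (intro mult_mono) (auto simp: mono_on_def)
    then have "(f' z)\<^sup>2 \<le> 2 * K * \<rho> x * x"
      using self[of z] K mult_left_mono[of "\<rho> (f z) * f z" "\<rho> x * x" "2 * K"]
      unfolding mult.assoc by linarith
    then have "(\<tau> x - \<tau> y)\<^sup>2 * (f' z)\<^sup>2 \<le> (\<tau> x - \<tau> y)\<^sup>2 * (2 * K * \<rho> x * x)"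
      by (intro mult_left_mono) auto
    ultimately show ?thesis using \<tau>(1)[of x] \<tau>(1)[of y] xy
      by (auto simp: power_mult_distrib)
  qed
  \<comment> \<open>The slope estimate from level 0, over at most unit time, divided by
    \<open>x\<close>.\<close>
  have lower: "x \<le> 2 * K * \<rho> x" if x: "0 < x" "x \<le> f 1" for x
  proof -
    have "x\<^sup>2 \<le> (\<tau> x - \<tau> 0)\<^sup>2 * (2 * K * \<rho> x * x)" using slope[of 0 x] x by auto
    also have "(\<tau> x - \<tau> 0)\<^sup>2 \<le> 1"
      using slope[of 0 x] \<tau>(1)[of 0] \<tau>(1)[of x] x by (auto intro!: power_le_one)
    then have "(\<tau> x - \<tau> 0)\<^sup>2 * (2 * K * \<rho> x * x) \<le> 1 * (2 * K * \<rho> x * x)"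
      using \<rho>(1)[of x] K x by (intro mult_right_mono) auto
    finally show ?thesis using x by (simp add: power2_eq_square)
  qed
  have pos: "0 < \<rho> x" if "0 < x" for x
  proof -
    define m where "m = min x (f 1)"
    have m: "0 < m" "m \<le> f 1" "m \<le> x" using that ends by (auto simp: m_def)
    then have "0 < 2 * K * \<rho> m" using lower[of m] by linarith
    then have "0 < \<rho> m" using K by (simp add: zero_less_mult_iff)
    also have "\<rho> m \<le> \<rho> x" using \<rho>(2) m by (auto simp: mono_on_def)
    finally show ?thesis .
  qed
  have "(\<lambda>x. 1 / \<rho> x) integrable_on {0..c}"
  proof (rule integrable_on_nonincreasing_singularity[OF ends(2) c])
    show "0 \<le> 1 / \<rho> x" if "0 < x" for x using pos[OF that] by simp
    show "1 / \<rho> y \<le> 1 / \<rho> x" if "0 < x" "x \<le> y" for x y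
      using pos[of x] pos[of y] \<rho>(2) that by (auto simp: mono_on_def intro!: divide_left_mono)
    show "0 \<le> 2 * K * \<tau> x \<and> 2 * K * \<tau> x \<le> 2 * K" if "0 < x" "x \<le> f 1" for x
      using \<tau>(1)[of x] that K by auto
    fix x y assume xy: "0 < y" "y < x" "x \<le> f 1"
    then have \<rho>x: "0 < \<rho> x" using pos by auto
    have "(x - y)\<^sup>2 \<le> (\<tau> x - \<tau> y)\<^sup>2 * (2 * K * \<rho> x * x)" using slope[of y x] xy by auto
    \<comment> \<open>Trading the factor \<open>x\<close> for \<open>2 * K * \<rho> x\<close> makes
      the right side a perfect square.\<close>
    also have "\<dots> \<le> (\<tau> x - \<tau> y)\<^sup>2 * (2 * K * \<rho> x * (2 * K * \<rho> x))"
      using lower[of x] xy \<rho>x K by (intro mult_left_mono) auto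
    also have "\<dots> = ((\<tau> x - \<tau> y) * (2 * K * \<rho> x))\<^sup>2" by (simp add: power2_eq_square)
    finally have "x - y \<le> (\<tau> x - \<tau> y) * (2 * K * \<rho> x)"
      using slope[of y x] xy \<rho>x K by (auto elim!: power2_le_imp_le)
    then show "1 / \<rho> x * (x - y) \<le> 2 * K * \<tau> x - 2 * K * \<tau> y"
      using \<rho>x by (simp add: field_simps)
  qed
  then show ?thesis using pos by blast
qed

section \<open>Positivity of \<open>rho0\<close> and the decrease of an adaptive step\<close>

lemma gradient_eq_0_at_minimum:
  assumes "F differentiable (at w)" and "\<And>v. F w \<le> F v"
  shows "gradient F w = 0"
proof -
  have "(\<lambda>h. h \<bullet> gradient F w) = (\<lambda>h. 0)"
    using differential_zero_maxmin[OF _ open_UNIV has_derivative_gradient[OF assms(1)]] assms(2)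
    by auto
  then show ?thesis by (metis inner_eq_zero_iff)
qed

text \<open>Without integrability of \<open>1 / \<rho>\<close>, \<open>theta\<close> would take the
  default value 0, so integrability is derived first: \<open>F\<close> leaves 0 along the segment
  from a minimiser to \<open>w\<close>, and \<open>K\<close> is the squared length of that
  segment.\<close>

lemma rho0_pos:
  assumes min0: "attains_minimum_value F 0" and reg: "second_order_self_bounding F \<rho>"
    and w: "0 < F w" and c: "F w \<le> c"
  shows "0 < \<rho> c \<and> 0 < rho0 \<rho> c"
proof -
  have td: "twice_differentiable F" and \<rho>: "\<And>x. 0 \<le> x \<Longrightarrow> 0 \<le> \<rho> x" "mono_on {0..} \<rho>"
    using reg by (auto simp: second_order_self_bounding_def)
  obtain m where m: "F m = 0" and nonneg: "\<And>w. 0 \<le> F w"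
    using min0 by (auto simp: attains_minimum_value_def)
  define v where "v = w - m"
  have v: "v \<noteq> 0" using m w by (auto simp: v_def)
  have self: "(v \<bullet> gradient F x)\<^sup>2 \<le> 2 * (norm v)\<^sup>2 * \<rho> (F x) * F x" for x
  proof -
    have "(v \<bullet> gradient F x)\<^sup>2 \<le> (norm v * norm (gradient F x))\<^sup>2"
      by (rule abs_le_square_iff[THEN iffD1]) (simp add: Cauchy_Schwarz_ineq2)
    also have "\<dots> \<le> (norm v)\<^sup>2 * (2 * \<rho> (F x) * F x)"
      unfolding power_mult_distrib
      by (intro mult_left_mono gradient_norm_self_bound[OF reg nonneg]) auto
    finally show ?thesis by (simp add: mult.commute mult.left_commute)
  qed
  have esc: "(\<forall>x>0. 0 < \<rho> x) \<and> (\<lambda>x. 1 / \<rho> x) integrable_on {0..c}"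
    using m w c v nonneg
    by (intro escape_from_zero[OF derivatives_along_line(1)[OF td, where w = m and v = v] _ self _ \<rho>])
       (auto simp: v_def)
  have c0: "0 < c" using w c by simp
  \<comment> \<open>Away from 0, \<open>1 / \<rho>\<close> is at least \<open>1 / \<rho> c\<close>,
    so half of the interval already makes \<open>theta\<close> positive.\<close>
  have int: "(\<lambda>x. 1 / \<rho> x) integrable_on {c / 2..c}"
    using integrable_subinterval_real[OF conjunct2[OF esc]] c0 by auto
  have "0 < c / 2 * (1 / \<rho> c)" using esc c0 by simp
  also have "\<dots> = integral {c / 2..c} (\<lambda>_. 1 / \<rho> c)" using c0 by simp
  also have "\<dots> \<le> integral {c / 2..c} (\<lambda>x. 1 / \<rho> x)"
    using esc c0 \<rho>(2) by (intro integral_le int) (auto simp: mono_on_def intro!: divide_left_mono)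
  also have "\<dots> \<le> theta \<rho> c" unfolding theta_def
    using esc c0 \<rho>(1) int by (intro integral_subset_le) auto
  finally show ?thesis using esc c0 by (auto simp: rho0_def)
qed

text \<open>Since \<open>L * \<eta> \<le> 1\<close>, the quadratic error costs at most half of the
  linear gain \<open>\<eta> * n^2\<close>, with \<open>n\<close> the gradient norm. For the step
  \<open>1 / L\<close> this gain exceeds \<open>\<epsilon>^2 / L\<close>; otherwise
  \<open>R * n > L\<close> and it equals \<open>n / R > L / R^2\<close>.\<close>

lemma adaptive_step_decrease:
  assumes reg: "second_order_self_bounding F \<rho>" and nonneg: "\<And>w. 0 \<le> F w"
    and L: "L = \<rho> (F\<^sub>0 + 1)" "0 < L" and R: "R = rho0 \<rho> (F\<^sub>0 + 1)" "0 < R"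
    and w: "F w \<le> F\<^sub>0" and eps: "0 < \<epsilon>" "\<epsilon> < norm (gradient F w)"
  shows "F (w - adaptive_step_size \<rho> F\<^sub>0 (gradient F w) *\<^sub>R gradient F w)
    < F w - min (L / R\<^sup>2) (\<epsilon>\<^sup>2 / L) / 2"
proof -
  define \<eta> n where "\<eta> = adaptive_step_size \<rho> F\<^sub>0 (gradient F w)" and "n = norm (gradient F w)"
  have n: "0 < n" "\<epsilon> < n" using eps by (auto simp: n_def)
  have \<eta>_eq: "\<eta> = min (1 / L) (1 / (R * n))"
    using n by (auto simp: \<eta>_def n_def adaptive_step_size_def L R)
  have \<eta>: "0 < \<eta>" "L * \<eta> \<le> 1" using L R n by (auto simp: \<eta>_eq min_def field_simps)
  have rho: "0 \<le> \<rho> (F w)" "\<rho> (F w) \<le> L"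
    using reg nonneg[of w] w by (auto simp: second_order_self_bounding_def mono_on_def L)
  have "\<rho> (F w) * \<eta> \<le> L * \<eta>" using rho \<eta> by (intro mult_right_mono) auto
  then have \<rho>\<eta>: "\<rho> (F w) * \<eta> \<le> 1" using \<eta> by linarith
  have "(\<rho> (F w) * \<eta>) * \<eta> \<le> 1 * \<eta>" using \<eta> \<rho>\<eta> by (intro mult_right_mono) auto
  then have "\<eta> / 2 \<le> \<eta> - \<rho> (F w) * \<eta>\<^sup>2 / 2" by (simp add: power2_eq_square)
  then have "\<eta> / 2 * n\<^sup>2 \<le> (\<eta> - \<rho> (F w) * \<eta>\<^sup>2 / 2) * n\<^sup>2" by (intro mult_right_mono) auto
  then have "F (w - \<eta> *\<^sub>R gradient F w) \<le> F w - \<eta> / 2 * n\<^sup>2"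
    using gradient_step_decrease[OF reg nonneg, of \<eta> w] \<eta> \<rho>\<eta> by (simp add: n_def)
  moreover have "min (L / R\<^sup>2) (\<epsilon>\<^sup>2 / L) < \<eta> * n\<^sup>2"
  proof (cases "R * n \<le> L")
    case True
    then have "\<eta> = 1 / L" using L R n by (auto simp: \<eta>_eq min_def field_simps)
    moreover have "\<epsilon>\<^sup>2 < n\<^sup>2" using n eps by (intro power_strict_mono) auto
    ultimately have "\<epsilon>\<^sup>2 / L < \<eta> * n\<^sup>2" using L by (simp add: divide_strict_right_mono)
    then show ?thesis by simp
  next
    case False
    then have "\<eta> = 1 / (R * n)" using L R n by (auto simp: \<eta>_eq min_def field_simps)
    then have "\<eta> * n\<^sup>2 = n / R" using n by (simp add: power2_eq_square)
    moreover have "L / R\<^sup>2 < n / R" using False R by (simp add: field_simps power2_eq_square)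
    ultimately show ?thesis by simp
  qed
  ultimately show ?thesis by (simp add: \<eta>_def)
qed

section \<open>Runs of the algorithm and the count of rounds\<close>

lemma adaptive_gd_Suc:
  "adaptive_gd orc \<eta> w (Suc n) = gd_round orc \<eta> (adaptive_gd orc \<eta> w n)"
  by (simp add: adaptive_gd_def)

lemma gd_round_sel:
  "iterate (gd_round orc \<eta> s) = iterate s - \<eta> (orc (iterate s)) *\<^sub>R orc (iterate s)"
  "oracle_calls (gd_round orc \<eta> s) = Suc (oracle_calls s)"
  "candidates (gd_round orc \<eta> s) = candidates s @ [iterate s]"
  by (cases s; simp add: Let_def)+

lemma adaptive_gd_counts:
  "oracle_calls (adaptive_gd orc \<eta> w n) = n \<and> length (candidates (adaptive_gd orc \<eta> w n)) = n"
  by (induction n) (auto simp: adaptive_gd_Suc gd_round_sel adaptive_gd_def[of _ _ _ 0])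

theorem theorem3p2:
  fixes F :: "real ^ 'n \<Rightarrow> real"
    and \<rho>\<^sub>1 :: "real \<Rightarrow> real"
    and \<epsilon> L T :: real
    and w\<^sub>0 :: "real ^ 'n"
    and s :: "(real ^ 'n) gd_state"
  assumes min0: "attains_minimum_value F 0"
    and reg: "second_order_self_bounding F \<rho>\<^sub>1"
    and eps: "\<epsilon> > 0"
    and L_eq: "L = \<rho>\<^sub>1 (F w\<^sub>0 + 1)"
    and T_eq: "T = 2 * F w\<^sub>0 / min (L / (rho0 \<rho>\<^sub>1 (F w\<^sub>0 + 1))\<^sup>2) (\<epsilon>\<^sup>2 / L)"
    and s_eq: "s = adaptive_gd (gradient F) (adaptive_step_size \<rho>\<^sub>1 (F w\<^sub>0)) w\<^sub>0 (num_candidates T)"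
  shows "real (oracle_calls s) \<le> T + 1 \<and>
         length (candidates s) = num_candidates T \<and>
         (\<exists>p \<in> set (candidates s). norm (gradient F p) \<le> \<epsilon>)"
proof -
  define run where "run n = adaptive_gd (gradient F) (adaptive_step_size \<rho>\<^sub>1 (F w\<^sub>0)) w\<^sub>0 n" for n
  define N where "N = num_candidates T"
  define m where "m = min (L / (rho0 \<rho>\<^sub>1 (F w\<^sub>0 + 1))\<^sup>2) (\<epsilon>\<^sup>2 / L)"
  have nonneg: "0 \<le> F w" for w using min0 by (simp add: attains_minimum_value_def)
  have "0 \<le> L"
    using reg nonneg[of w\<^sub>0] by (simp add: L_eq second_order_self_bounding_def)
  \<comment> \<open>The denominator may still be 0 here; division by 0 yields 0, so the sign is
    right in every case.\<close>
  then have "0 \<le> T" using nonneg[of w\<^sub>0] by (auto simp: T_eq)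
  then have N: "real N \<le> T + 1" "T \<le> real N" "1 \<le> N"
    by (auto simp: N_def num_candidates_def max_def) linarith+
  have s: "s = run N" by (simp add: s_eq run_def N_def)
  have "\<exists>p \<in> set (candidates (run N)). norm (gradient F p) \<le> \<epsilon>"
  \<comment> \<open>\<open>rho0_pos\<close> at \<open>w\<^sub>0\<close> needs a positive value. At a
    minimiser \<open>T\<close> is 0 whatever the denominator, and the single candidate is
    stationary.\<close>
  proof (cases "F w\<^sub>0 = 0")
    case True
    then have "T = 0" by (simp add: T_eq)
    then have "N = Suc 0" by (simp add: N_def num_candidates_def)
    moreover have "gradient F w\<^sub>0 = 0"
      using reg nonneg True
      by (intro gradient_eq_0_at_minimum)
         (auto simp: second_order_self_bounding_def twice_differentiable_def)
    ultimately show ?thesis using eps by (simp add: run_def adaptive_gd_def)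
  next
    case False
    then have pos: "0 < L" "0 < rho0 \<rho>\<^sub>1 (F w\<^sub>0 + 1)"
      using rho0_pos[OF min0 reg, of w\<^sub>0 "F w\<^sub>0 + 1"] nonneg[of w\<^sub>0] by (auto simp: L_eq)
    then have m: "0 < m" using eps by (simp add: m_def)
    show ?thesis
    proof (rule ccontr)
      assume none: "\<not> ?thesis"
      \<comment> \<open>Candidates are only appended, and iterate \<open>n\<close> is appended in
        round \<open>Suc n\<close>, so every iterate before \<open>N\<close> is among them.\<close>
      have "set (candidates (run n)) \<subseteq> set (candidates (run N))" if "n \<le> N" for n
        using that by (induction rule: inc_induct) (auto simp: run_def adaptive_gd_Suc gd_round_sel)
      then have large: "\<epsilon> < norm (gradient F (iterate (run n)))" if "n < N" for n
        using that none Suc_leI[OF that]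
        by (force simp: run_def adaptive_gd_Suc gd_round_sel not_le)
      \<comment> \<open>The decrease is strict for \<open>n \<noteq> 0\<close>, which decides the case that \<open>T\<close> is an integer.\<close>
      have "F (iterate (run n)) \<le> F w\<^sub>0 - real n * (m / 2) \<and>
          (n \<noteq> 0 \<longrightarrow> F (iterate (run n)) < F w\<^sub>0 - real n * (m / 2))" if "n \<le> N" for n
        using that
      proof (induction n)
        case 0
        then show ?case by (simp add: run_def adaptive_gd_def)
      next
        case (Suc n)
        \<comment> \<open>Iterates never rise above \<open>F w\<^sub>0\<close>, so the constants
          fixed at the start remain valid.\<close>
        have "0 \<le> real n * (m / 2)" using m by simp
        then have "F (iterate (run n)) \<le> F w\<^sub>0" using Suc by linarith
        from adaptive_step_decrease[OF reg nonneg L_eq pos(1) refl pos(2) this eps large]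
        have "F (iterate (run (Suc n))) < F (iterate (run n)) - m / 2"
          using Suc by (simp add: run_def adaptive_gd_Suc gd_round_sel m_def)
        then show ?case using Suc by (simp add: algebra_simps add_divide_distrib)
      qed
      from this[of N] N have "F (iterate (run N)) < F w\<^sub>0 - real N * (m / 2)" by auto
      \<comment> \<open>By the choice of \<open>T\<close>, \<open>T * (m / 2) = F w\<^sub>0\<close>,
        so \<open>N\<close> large gradients would push \<open>F\<close> below 0.\<close>
      also have "T * (m / 2) \<le> real N * (m / 2)" using N m by (intro mult_right_mono) auto
      then have "F w\<^sub>0 - real N * (m / 2) \<le> 0" using m by (simp add: T_eq m_def[symmetric])
      finally show False using nonneg[of "iterate (run N)"] by simp
    qed
  qed
  then show ?thesis
    using N by (simp add: s adaptive_gd_counts run_def N_def)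
qed

end
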